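(* Let $n\ge 2$. For any permutation $\pi$ of $\{0,\dots,n-1\}$, written as a sequence $\pi(1),\dots,\pi(n)$, $$\Sigma(L_\pi)=n(n-1)-\sum_{k=1}^{n-1}\delta_k,$$ where $\delta_k=(\pi(k+1)-\pi(k))\bmod n\in\{1,\dots,n-1\}$.
   Context: A Latin square of order $n$ here is an $n\times n$ array with symbols in $\{0,\dots,n-1\}$ (ordered as integers) in which every row and every column contains each symbol exactly once. $C(i,j)=(i+j)\bmod n$, $i,j\in\{0,\dots,n-1\}$, is the cyclic Latin square. For a sequence $\pi(1),\dots,\pi(n)$ listing each element of $\{0,\dots,n-1\}$ exactly once, $L_\pi$ is the Latin square whose rows, in order, are the rows of $C$ indexed by $\pi(1),\dots,\pi(n)$; that is, the $k$-th row of $L_\pi$ ($1\le k\le n$) has entry $(\pi(k)+c)\bmod n$ in column $c\in\{0,\dots,n-1\}$. For a Latin square $L$, $\Sigma(L)$ is the total number of column ascents: the number of pairs (consecutive rows $k,k+1$; column $c$) such that the entry in row $k$, column $c$ is strictly less than the entry in row $k+1$, column $c$. *)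

theory Defs
  imports Main
begin

text \<open>
  An array is a function taking a row index and a column index to an entry.  Columns and symbols
  are always \<open>{..<n}\<close>; the row index set is a parameter because the rows of the cyclic square are
  numbered from 0 and those of its row permutations from 1.  Values outside the index ranges are
  irrelevant.
\<close>

definition latin_square :: "nat \<Rightarrow> nat set \<Rightarrow> (nat \<Rightarrow> nat \<Rightarrow> nat) \<Rightarrow> bool" where
  "latin_square n R L \<longleftrightarrow> finite R \<and> card R = n \<and>
     (\<forall>r\<in>R. bij_betw (\<lambda>c. L r c) {..<n} {..<n}) \<and>
     (\<forall>c<n. bij_betw (\<lambda>r. L r c) R {..<n})"

definition cyclic_square :: "nat \<Rightarrow> nat \<Rightarrow> nat \<Rightarrow> nat" where
  "cyclic_square n i j = (i + j) mod n"

definition row_perm_square :: "nat \<Rightarrow> (nat \<Rightarrow> nat) \<Rightarrow> nat \<Rightarrow> nat \<Rightarrow> nat" where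
  "row_perm_square n \<pi> k = cyclic_square n (\<pi> k)"

text \<open>Rows are numbered \<open>1, \<dots>, n\<close> here.\<close>

definition column_ascents :: "nat \<Rightarrow> (nat \<Rightarrow> nat \<Rightarrow> nat) \<Rightarrow> nat" where
  "column_ascents n L = card {(k, c). 1 \<le> k \<and> k < n \<and> c < n \<and> L k c < L (k + 1) c}"

text \<open>The difference is taken in the integers, where it is not truncated and where \<open>mod\<close> by a
  positive modulus is nonnegative.\<close>

definition row_gap :: "nat \<Rightarrow> (nat \<Rightarrow> nat) \<Rightarrow> nat \<Rightarrow> int" where
  "row_gap n \<pi> k = (int (\<pi> (k + 1)) - int (\<pi> k)) mod int n"

lemma bij_betw_add_mod: "bij_betw (\<lambda>c. (a + c) mod n) {..<n} {..<n}" for a n :: nat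
proof (rule bij_betwI')
  fix x y :: nat assume xy: "x \<in> {..<n}" "y \<in> {..<n}"
  show "((a + x) mod n = (a + y) mod n) = (x = y)"
  proof
    assume "(a + x) mod n = (a + y) mod n"
    then have "(int a + int x) mod int n = (int a + int y) mod int n"
      by (metis of_nat_add of_nat_mod)
    then have "(int a + int x - int a) mod int n = (int a + int y - int a) mod int n"
      by (metis mod_diff_left_eq)
    then show "x = y" using xy by simp
  qed simp
next
  fix y assume y: "y \<in> {..<n}"
  define x where "x = nat ((int y - int a) mod int n)"
  have n: "0 < int n" using y by auto
  have "int x = (int y - int a) mod int n" using n by (simp add: x_def)
  then have "int ((a + x) mod n) = int y"
    using y by (simp add: of_nat_mod mod_add_right_eq)
  moreover have "x < n" using n by (simp add: x_def nat_less_iff)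
  ultimately show "\<exists>x\<in>{..<n}. y = (a + x) mod n" by (metis lessThan_iff of_nat_eq_iff)
qed (auto intro: mod_less_divisor)

lemma latin_square_cyclic_square: "latin_square n {..<n} (cyclic_square n)"
  using bij_betw_add_mod[of _ n]
  by (simp add: latin_square_def cyclic_square_def add.commute[of _ "_::nat"])

lemma latin_square_row_perm_square:
  assumes "bij_betw \<pi> {1..n} {..<n}"
  shows "latin_square n {1..n} (row_perm_square n \<pi>)"
proof -
  have "bij_betw (\<lambda>k. (\<pi> k + c) mod n) {1..n} {..<n}" for c
    using bij_betw_trans[OF assms bij_betw_add_mod[of c n]] by (simp add: o_def add.commute)
  then show ?thesis
    using bij_betw_add_mod[of _ n]
    by (simp add: latin_square_def row_perm_square_def cyclic_square_def)
qed

end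

theory Submission
  imports Defs
begin

text \<open>
  The row below row \<open>k\<close> arises from row \<open>k\<close> by adding the gap \<open>\<delta>\<close> to every entry modulo \<open>n\<close>. Adding
  \<open>\<delta> \<in> {1..n-1}\<close> to a symbol \<open>x\<close> increases it exactly when the sum does not wrap around, that is,
  when \<open>x < n - \<delta>\<close>. A row contains every symbol once, so there are exactly \<open>n - \<delta>\<close> ascents between
  the two rows, wherever the symbols stand. Summing \<open>n - \<delta>\<close> over the \<open>n - 1\<close> pairs of consecutive
  rows gives the formula. The ascents between two cyclic rows are counted in
  \<open>card_ascents_shifted_rows\<close>; injectivity of the permutation excludes the gap 0, for which the
  count would be 0 instead of \<open>n\<close> (\<open>row_gap_bounds\<close>).
\<close>

text \<open>If the sum wraps around, the result is \<open>x - (n - d)\<close>, which lies below \<open>x\<close> because \<open>d < n\<close>.\<close>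

lemma less_add_mod_iff:
  fixes x d n :: nat
  assumes "x < n" "0 < d" "d < n"
  shows "x < (x + d) mod n \<longleftrightarrow> x + d < n"
proof (cases "x + d < n")
  case True
  then show ?thesis using assms by simp
next
  case False
  then have "(x + d) mod n = x + d - n"
    using assms by (simp add: le_mod_geq)
  then show ?thesis using False assms by simp
qed

text \<open>
  Reindexing the columns of the upper row by the symbols they carry turns the count into that of the
  symbols that do not wrap around.
\<close>

lemma card_ascents_shifted_rows:
  fixes a b d n :: nat
  assumes "0 < d" "d < n" and shift: "(a + d) mod n = b mod n"
  shows "card {c. c < n \<and> (a + c) mod n < (b + c) mod n} = n - d"
proof -
  let ?f = "\<lambda>c. (a + c) mod n"
  let ?A = "{c. c < n \<and> ?f c < (b + c) mod n}"
  have bij: "bij_betw ?f {..<n} {..<n}"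
    by (rule bij_betw_add_mod)
  have asc: "?f c < (b + c) mod n \<longleftrightarrow> ?f c < n - d" for c
  proof -
    have "(b + c) mod n = (a + d + c) mod n"
      using mod_add_cong[OF shift refl[of "c mod n"]] by simp
    also have "\<dots> = (?f c + d) mod n"
      using mod_add_left_eq[of "a + c" n d] by (simp add: ac_simps)
    finally show ?thesis
      using less_add_mod_iff[of "?f c" n d] assms by (simp add: less_diff_conv)
  qed
  have "?f ` ?A = {..<n - d}"
  proof
    show "?f ` ?A \<subseteq> {..<n - d}" using asc by auto
    show "{..<n - d} \<subseteq> ?f ` ?A"
    proof
      fix x assume x: "x \<in> {..<n - d}"
      then have "x \<in> ?f ` {..<n}" using bij by (simp add: bij_betw_def)
      then obtain c where "c < n" "x = ?f c" by auto
      then show "x \<in> ?f ` ?A" using x asc by auto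
    qed
  qed
  moreover have "inj_on ?f ?A"
    using bij by (auto simp: bij_betw_def intro: inj_on_subset)
  ultimately show ?thesis using card_image[of ?f ?A] by simp
qed

lemma row_gap_bounds:
  assumes "bij_betw \<pi> {1..n} {..<n}" and k: "k \<in> {1..n-1}"
  shows "row_gap n \<pi> k \<in> {1..int n - 1}"
proof -
  have mem: "k \<in> {1..n}" "k + 1 \<in> {1..n}" using k by auto
  then have lt: "\<pi> k < n" "\<pi> (k + 1) < n"
    using assms(1) by (auto simp: bij_betw_def)
  have "\<pi> (k + 1) \<noteq> \<pi> k"
    using assms(1) mem by (auto simp: bij_betw_def dest: inj_onD)
  moreover have "\<pi> (k + 1) = \<pi> k" if "row_gap n \<pi> k = 0"
  proof -
    have "int (\<pi> (k + 1)) mod int n = int (\<pi> k) mod int n"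
      using that unfolding row_gap_def by (simp add: mod_eq_dvd_iff mod_0_imp_dvd)
    then show ?thesis using lt by simp
  qed
  ultimately have "row_gap n \<pi> k \<noteq> 0" by blast
  moreover have "0 \<le> row_gap n \<pi> k" "row_gap n \<pi> k < int n"
    using lt by (auto simp: row_gap_def)
  ultimately show ?thesis by simp
qed

lemma card_ascents_row_perm_square:
  assumes "bij_betw \<pi> {1..n} {..<n}" and "k \<in> {1..n-1}"
  shows "int (card {c. c < n \<and> row_perm_square n \<pi> k c < row_perm_square n \<pi> (k + 1) c}) =
    int n - row_gap n \<pi> k"
proof -
  define d where "d = nat (row_gap n \<pi> k)"
  have d: "int d = row_gap n \<pi> k" "0 < d" "d < n"
    using row_gap_bounds[OF assms] by (auto simp: d_def)
  have "int ((\<pi> k + d) mod n) = int (\<pi> (k + 1) mod n)"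
    using d(1) by (simp add: of_nat_mod row_gap_def mod_add_right_eq)
  then have "(\<pi> k + d) mod n = \<pi> (k + 1) mod n"
    by (simp only: of_nat_eq_iff)
  from card_ascents_shifted_rows[OF d(2,3) this] show ?thesis
    using d by (simp add: row_perm_square_def cyclic_square_def)
qed

lemma column_ascents_eq_sum:
  "column_ascents n L = (\<Sum>k=1..n-1. card {c. c < n \<and> L k c < L (k + 1) c})"
proof -
  have "{(k, c). 1 \<le> k \<and> k < n \<and> c < n \<and> L k c < L (k + 1) c} =
      (SIGMA k:{1..n-1}. {c. c < n \<and> L k c < L (k + 1) c})"
    by auto
  then show ?thesis by (simp add: column_ascents_def)
qed

theorem proposition4p5:
  fixes n :: nat and \<pi> :: "nat \<Rightarrow> nat"
  assumes "n \<ge> 2"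
    and "bij_betw \<pi> {1..n} {..<n}"
  shows "(\<forall>k\<in>{1..n-1}. row_gap n \<pi> k \<in> {1..int n - 1}) \<and>
    int (column_ascents n (row_perm_square n \<pi>)) =
      int n * (int n - 1) - (\<Sum>k=1..n-1. row_gap n \<pi> k)"
proof
  show "\<forall>k\<in>{1..n-1}. row_gap n \<pi> k \<in> {1..int n - 1}"
    using row_gap_bounds[OF assms(2)] by blast
  have "int (column_ascents n (row_perm_square n \<pi>)) =
      (\<Sum>k=1..n-1. int n - row_gap n \<pi> k)"
    unfolding column_ascents_eq_sum of_nat_sum
    by (rule sum.cong) (simp_all only: card_ascents_row_perm_square[OF assms(2)])
  also have "\<dots> = int n * (int n - 1) - (\<Sum>k=1..n-1. row_gap n \<pi> k)"
    using assms(1) by (simp add: sum_subtractf algebra_simps)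
  finally show "int (column_ascents n (row_perm_square n \<pi>)) =
      int n * (int n - 1) - (\<Sum>k=1..n-1. row_gap n \<pi> k)" .
qed

end
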